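(* Let $(\mathfrak h,\nu,S)$ be a Hom-Lie algebra over $\mathbb F$ with $S$ a centroid for $\nu$. Let $\nu^{\ast}:\mathfrak h\to\mathfrak{gl}(\mathfrak h^{\ast})$ be the linear map defined by $\nu^{\ast}(x)(\alpha)(y)=-\alpha(\nu(x,y))$ for $x,y\in\mathfrak h$, $\alpha\in\mathfrak h^{\ast}$. Let $\mathfrak g=\mathfrak h\oplus\mathfrak h^{\ast}$ and define, for $x,y\in\mathfrak h$ and $\alpha,\beta\in\mathfrak h^{\ast}$, $$\mu(x+\alpha,y+\beta)=\nu(x,y)+\nu^{\ast}(x)(\beta)-\nu^{\ast}(y)(\alpha),$$ $$T(x+\alpha)=S(x)+S^{\ast}(\alpha),\qquad B(x+\alpha,y+\beta)=\alpha(y)+\beta(x),$$ where $S^{\ast}(\alpha)=\alpha\circ S$. Then $(\mathfrak g,\mu,T,B)$ is a quadratic Hom-Lie algebra having $T$ in its centroid.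
   Context: All vector spaces are finite dimensional over an algebraically closed field $\mathbb F$ of characteristic zero. A Hom-Lie algebra is a triple $(\mathfrak g,\mu,T)$ with $\mathfrak g$ a vector space, $\mu:\mathfrak g\times\mathfrak g\to\mathfrak g$ bilinear and skew-symmetric, and $T:\mathfrak g\to\mathfrak g$ linear, such that $\mu(T(x),\mu(y,z))+\mu(T(y),\mu(z,x))+\mu(T(z),\mu(x,y))=0$ for all $x,y,z\in\mathfrak g$. $T$ is a centroid for $\mu$ (is in the centroid of $(\mathfrak g,\mu)$) if $T(\mu(x,y))=\mu(T(x),y)$ for all $x,y$. A quadratic Hom-Lie algebra $(\mathfrak g,\mu,T,B)$ is a Hom-Lie algebra with a symmetric non-degenerate bilinear form $B$ on $\mathfrak g$ such that $B(\mu(x,y),z)=B(x,\mu(y,z))$ and $B(T(x),y)=B(x,T(y))$ for all $x,y,z$. *)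

theory Defs
  imports
    "HOL-Computational_Algebra.Polynomial"
    "HOL-Library.Function_Algebras"
    "HOL-Library.Product_Plus"
begin

text \<open>
  A vector space is a subspace \<open>V\<close> of an ambient type-level vector space, because a dual space
  cannot be a whole type. Maps on \<open>V\<close> are total functions of which only the values on \<open>V\<close> matter.
\<close>

locale fin_dim_space = vector_space scale
  for scale :: "'f::field \<Rightarrow> 'v::ab_group_add \<Rightarrow> 'v" (infixr \<open>*s\<close> 75) +
  fixes V :: "'v set"
  assumes subspace: "subspace V"
    and finitely_spanned: "\<exists>A. finite A \<and> span A = V"

definition linear_map_on ::
  "('f::field \<Rightarrow> 'v::ab_group_add \<Rightarrow> 'v) \<Rightarrow> 'v set \<Rightarrow> ('f \<Rightarrow> 'w::ab_group_add \<Rightarrow> 'w) \<Rightarrow> 'w set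
    \<Rightarrow> ('v \<Rightarrow> 'w) \<Rightarrow> bool" where
  "linear_map_on s V s' W f \<longleftrightarrow>
    (\<forall>x\<in>V. f x \<in> W) \<and>
    (\<forall>x\<in>V. \<forall>y\<in>V. f (x + y) = f x + f y) \<and>
    (\<forall>c. \<forall>x\<in>V. f (s c x) = s' c (f x))"

definition bilinear_map_on ::
  "('f::field \<Rightarrow> 'v::ab_group_add \<Rightarrow> 'v) \<Rightarrow> 'v set \<Rightarrow> ('f \<Rightarrow> 'w::ab_group_add \<Rightarrow> 'w) \<Rightarrow> 'w set
    \<Rightarrow> ('v \<Rightarrow> 'v \<Rightarrow> 'w) \<Rightarrow> bool" where
  "bilinear_map_on s V s' W f \<longleftrightarrow>
    (\<forall>x\<in>V. linear_map_on s V s' W (\<lambda>y. f x y)) \<and>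
    (\<forall>y\<in>V. linear_map_on s V s' W (\<lambda>x. f x y))"

locale hom_lie_algebra = fin_dim_space scale V
  for scale :: "'f::field \<Rightarrow> 'v::ab_group_add \<Rightarrow> 'v" and V :: "'v set" +
  fixes \<mu> :: "'v \<Rightarrow> 'v \<Rightarrow> 'v" and T :: "'v \<Rightarrow> 'v"
  assumes bilinear: "bilinear_map_on scale V scale V \<mu>"
    and skew_symmetric: "\<lbrakk>x \<in> V; y \<in> V\<rbrakk> \<Longrightarrow> \<mu> x y = - \<mu> y x"
    and linear_twist: "linear_map_on scale V scale V T"
    and hom_jacobi: "\<lbrakk>x \<in> V; y \<in> V; z \<in> V\<rbrakk> \<Longrightarrow>
      \<mu> (T x) (\<mu> y z) + \<mu> (T y) (\<mu> z x) + \<mu> (T z) (\<mu> x y) = 0"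

definition in_centroid :: "'v set \<Rightarrow> ('v \<Rightarrow> 'v \<Rightarrow> 'v) \<Rightarrow> ('v \<Rightarrow> 'v) \<Rightarrow> bool" where
  "in_centroid V \<mu> T \<longleftrightarrow> (\<forall>x\<in>V. \<forall>y\<in>V. T (\<mu> x y) = \<mu> (T x) y)"

locale quadratic_hom_lie_algebra = hom_lie_algebra scale V \<mu> T
  for scale :: "'f::field \<Rightarrow> 'v::ab_group_add \<Rightarrow> 'v" and V :: "'v set"
    and \<mu> :: "'v \<Rightarrow> 'v \<Rightarrow> 'v" and T :: "'v \<Rightarrow> 'v" +
  fixes B :: "'v \<Rightarrow> 'v \<Rightarrow> 'f"
  assumes bilinear_form: "bilinear_map_on scale V (*) UNIV B"
    and symmetric: "\<lbrakk>x \<in> V; y \<in> V\<rbrakk> \<Longrightarrow> B x y = B y x"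
    and nondegenerate: "\<lbrakk>x \<in> V; \<And>y. y \<in> V \<Longrightarrow> B x y = 0\<rbrakk> \<Longrightarrow> x = 0"
    and invariant: "\<lbrakk>x \<in> V; y \<in> V; z \<in> V\<rbrakk> \<Longrightarrow> B (\<mu> x y) z = B x (\<mu> y z)"
    and self_adjoint: "\<lbrakk>x \<in> V; y \<in> V\<rbrakk> \<Longrightarrow> B (T x) y = B x (T y)"

text \<open>
  A linear form on \<open>H\<close> is represented by the function that extends it by \<open>0\<close> outside \<open>H\<close>, so that
  equality of functions is equality of forms and the dual is a subspace under pointwise operations.
  This is the only reason for the case distinctions on \<open>y \<in> H\<close> below.
\<close>

definition dual_space ::
  "('f::field \<Rightarrow> 'v::ab_group_add \<Rightarrow> 'v) \<Rightarrow> 'v set \<Rightarrow> ('v \<Rightarrow> 'f) set" where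
  "dual_space scale H = {\<alpha>. linear_map_on scale H (*) UNIV \<alpha> \<and> (\<forall>x. x \<notin> H \<longrightarrow> \<alpha> x = 0)}"

definition coadjoint ::
  "'v set \<Rightarrow> ('v \<Rightarrow> 'v \<Rightarrow> 'v) \<Rightarrow> 'v \<Rightarrow> ('v \<Rightarrow> 'f::field) \<Rightarrow> ('v \<Rightarrow> 'f)" where
  "coadjoint H \<nu> x \<alpha> = (\<lambda>y. if y \<in> H then - \<alpha> (\<nu> x y) else 0)"

definition dual_map :: "'v set \<Rightarrow> ('v \<Rightarrow> 'v) \<Rightarrow> ('v \<Rightarrow> 'f::field) \<Rightarrow> ('v \<Rightarrow> 'f)" where
  "dual_map H S \<alpha> = (\<lambda>y. if y \<in> H then \<alpha> (S y) else 0)"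

text \<open>The element \<open>x + \<alpha>\<close> of the direct sum of \<open>H\<close> and its dual is the pair \<open>(x, \<alpha>)\<close>.\<close>

definition double_scale ::
  "('f::field \<Rightarrow> 'v \<Rightarrow> 'v) \<Rightarrow> 'f \<Rightarrow> 'v \<times> ('v \<Rightarrow> 'f) \<Rightarrow> 'v \<times> ('v \<Rightarrow> 'f)" where
  "double_scale scale c = (\<lambda>(x, \<alpha>). (scale c x, \<lambda>y. c * \<alpha> y))"

definition double_space ::
  "('f::field \<Rightarrow> 'v::ab_group_add \<Rightarrow> 'v) \<Rightarrow> 'v set \<Rightarrow> ('v \<times> ('v \<Rightarrow> 'f)) set" where
  "double_space scale H = H \<times> dual_space scale H"

definition double_bracket ::
  "'v set \<Rightarrow> ('v \<Rightarrow> 'v \<Rightarrow> 'v)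
    \<Rightarrow> 'v \<times> ('v \<Rightarrow> 'f::field) \<Rightarrow> 'v \<times> ('v \<Rightarrow> 'f) \<Rightarrow> 'v \<times> ('v \<Rightarrow> 'f)" where
  "double_bracket H \<nu> = (\<lambda>(x, \<alpha>) (y, \<beta>). (\<nu> x y, coadjoint H \<nu> x \<beta> - coadjoint H \<nu> y \<alpha>))"

definition double_twist ::
  "'v set \<Rightarrow> ('v \<Rightarrow> 'v) \<Rightarrow> 'v \<times> ('v \<Rightarrow> 'f::field) \<Rightarrow> 'v \<times> ('v \<Rightarrow> 'f)" where
  "double_twist H S = (\<lambda>(x, \<alpha>). (S x, dual_map H S \<alpha>))"

definition double_form :: "'v \<times> ('v \<Rightarrow> 'f::field) \<Rightarrow> 'v \<times> ('v \<Rightarrow> 'f) \<Rightarrow> 'f" where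
  "double_form = (\<lambda>(x, \<alpha>) (y, \<beta>). \<alpha> y + \<beta> x)"

end

theory Submission
  imports Defs
begin

text \<open>
  On the summand \<open>H\<close> the Hom-Jacobi identity of the double is that of \<open>H\<close>. Evaluated at \<open>w \<in> H\<close>,
  the component in the dual is a sum of three terms, one for each of the linear forms involved; since
  \<open>S\<close> is in the centroid, \<open>S\<close> can be moved inside nested brackets at will, and each term becomes a
  linear form applied to a Hom-Jacobi sum in \<open>H\<close>. Finite dimensionality comes from a dual basis.
\<close>

section \<open>Linear maps on a subspace of an ambient space\<close>

lemma sum_fun_apply: "sum f A x = (\<Sum>a\<in>A. f a x)"
  by (induction A rule: infinite_finite_induct) auto

lemma linear_map_on_add:
  "linear_map_on s V s' W f \<Longrightarrow> x \<in> V \<Longrightarrow> y \<in> V \<Longrightarrow> f (x + y) = f x + f y"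
  by (simp add: linear_map_on_def)

lemma linear_map_on_scale: "linear_map_on s V s' W f \<Longrightarrow> x \<in> V \<Longrightarrow> f (s c x) = s' c (f x)"
  by (simp add: linear_map_on_def)

text \<open>\<open>fin_dim_space\<close> asks for an ambient vector space. For the double this is
  the type of all pairs of a vector and an arbitrary function; linearity of the second component
  enters only through the carrier \<open>double_space\<close>.\<close>

lemma vector_space_double_scale:
  fixes scale :: "'f::field \<Rightarrow> 'v::ab_group_add \<Rightarrow> 'v"
  assumes "vector_space scale"
  shows "vector_space (double_scale scale)"
proof -
  interpret vector_space scale by fact
  show ?thesis
    by unfold_locales
      (auto simp: double_scale_def algebra_simps fun_eq_iff scale_right_distrib scale_left_distrib)
qed

context fin_dim_space
begin

text \<open>Maps are linear only on \<open>V\<close>, so each linearity rewrite has membership side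
  conditions; these simp rules discharge them.\<close>

lemma space_closed [simp]:
  "0 \<in> V" "x \<in> V \<Longrightarrow> y \<in> V \<Longrightarrow> x + y \<in> V" "x \<in> V \<Longrightarrow> y \<in> V \<Longrightarrow> x - y \<in> V"
  "x \<in> V \<Longrightarrow> - x \<in> V" "x \<in> V \<Longrightarrow> scale c x \<in> V"
  using subspace by (auto intro: subspace_0 subspace_add subspace_diff subspace_neg subspace_scale)

lemma linear_map_on_neg:
  fixes s' :: "'f \<Rightarrow> 'w::ab_group_add \<Rightarrow> 'w"
  assumes "linear_map_on scale V s' W f" "x \<in> V"
  shows "f (- x) = - f x"
proof -
  have "f (0 + 0) = f 0 + f 0" by (rule linear_map_on_add[OF assms(1)]) simp_all
  then have "f (x + - x) = 0" by simp
  moreover have "f (x + - x) = f x + f (- x)"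
    by (rule linear_map_on_add[OF assms(1)]) (simp_all add: assms)
  ultimately show ?thesis by (metis add.inverse_unique)
qed

lemma linear_map_on_zero:
  fixes s' :: "'f \<Rightarrow> 'w::ab_group_add \<Rightarrow> 'w"
  assumes "linear_map_on scale V s' W f"
  shows "f 0 = 0"
  using linear_map_on_add[OF assms, of 0 0] by simp

lemma linear_map_on_diff:
  fixes s' :: "'f \<Rightarrow> 'w::ab_group_add \<Rightarrow> 'w"
  assumes "linear_map_on scale V s' W f" "x \<in> V" "y \<in> V"
  shows "f (x - y) = f x - f y"
  using linear_map_on_add[OF assms(1), of x "- y"] linear_map_on_neg[OF assms(1)] assms by simp

lemma linear_map_on_sum:
  fixes s' :: "'f \<Rightarrow> 'w::ab_group_add \<Rightarrow> 'w"
  assumes "linear_map_on scale V s' W f" "\<And>a. a \<in> A \<Longrightarrow> g a \<in> V"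
  shows "f (sum g A) = (\<Sum>a\<in>A. f (g a))"
  using assms(2)
proof (induction A rule: infinite_finite_induct)
  case (insert a A)
  then have "sum g A \<in> V" using subspace by (intro subspace_sum) auto
  with insert show ?case by (simp add: linear_map_on_add[OF assms(1)])
qed (simp_all add: linear_map_on_zero[OF assms(1)])

section \<open>Linear forms extended by zero, and the dual basis\<close>

lemma dual_space_simps:
  assumes "\<alpha> \<in> dual_space scale V" "x \<in> V"
  shows "y \<in> V \<Longrightarrow> \<alpha> (x + y) = \<alpha> x + \<alpha> y" "y \<in> V \<Longrightarrow> \<alpha> (x - y) = \<alpha> x - \<alpha> y"
    "\<alpha> (scale c x) = c * \<alpha> x" "\<alpha> (- x) = - \<alpha> x"
proof -
  have lin: "linear_map_on scale V (*) UNIV \<alpha>"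
    using assms by (simp add: dual_space_def)
  show "y \<in> V \<Longrightarrow> \<alpha> (x + y) = \<alpha> x + \<alpha> y" "y \<in> V \<Longrightarrow> \<alpha> (x - y) = \<alpha> x - \<alpha> y"
    "\<alpha> (scale c x) = c * \<alpha> x" "\<alpha> (- x) = - \<alpha> x"
    using assms(2) linear_map_on_add[OF lin] linear_map_on_diff[OF lin] linear_map_on_scale[OF lin]
      linear_map_on_neg[OF lin] by auto
qed

lemma dual_space_outside: "\<alpha> \<in> dual_space scale V \<Longrightarrow> x \<notin> V \<Longrightarrow> \<alpha> x = 0"
  by (simp add: dual_space_def)

lemma dual_spaceI:
  assumes "\<And>x y. x \<in> V \<Longrightarrow> y \<in> V \<Longrightarrow> \<alpha> (x + y) = \<alpha> x + \<alpha> y"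
    and "\<And>c x. x \<in> V \<Longrightarrow> \<alpha> (scale c x) = c * \<alpha> x"
    and "\<And>x. x \<notin> V \<Longrightarrow> \<alpha> x = 0"
  shows "\<alpha> \<in> dual_space scale V"
  using assms by (simp add: dual_space_def linear_map_on_def)

lemma zero_in_dual: "0 \<in> dual_space scale V"
  by (rule dual_spaceI) simp_all

text \<open>The forms \<open>\<phi> a\<close> are the dual basis of a finite basis \<open>A\<close>
  of \<open>V\<close>, so the coefficient of \<alpha> at \<open>a\<close> is
  \<open>\<alpha> a\<close>. The expansion is an equation of functions, ready to serve as the second
  component of a sum of pairs.\<close>

lemma dual_space_finitely_spanned:
  obtains A \<phi> where "finite A" "\<And>a. a \<in> A \<Longrightarrow> \<phi> a \<in> dual_space scale V"
    "\<And>\<alpha>. \<alpha> \<in> dual_space scale V \<Longrightarrow> \<alpha> = (\<Sum>a\<in>A. (\<lambda>y. \<alpha> a * \<phi> a y))"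
proof -
  obtain F where F: "finite F" "span F = V" using finitely_spanned by blast
  obtain A where A: "A \<subseteq> V" "independent A" "V \<subseteq> span A"
    by (meson basis_exists)
  have spanA: "span A = V" using A by (metis span_minimal subspace subset_antisym)
  have finA: "finite A" using independent_span_bound[OF F(1) A(2)] A(1) F(2) by simp
  \<comment> \<open>The coordinate along \<open>a\<close>, with value 0 outside \<open>V\<close> as
    membership in \<open>dual_space\<close> demands.\<close>
  define \<phi> where "\<phi> a y = (if y \<in> V then representation A y a else 0)" for a y
  show ?thesis
  proof
    show "finite A" by fact
    show "\<phi> a \<in> dual_space scale V" for a
      by (rule dual_spaceI)
        (simp_all add: \<phi>_def representation_add[OF A(2)] representation_scale[OF A(2)] spanA)
    fix \<alpha> assume \<alpha>: "\<alpha> \<in> dual_space scale V"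
    then have lin: "linear_map_on scale V (*) UNIV \<alpha>" by (simp add: dual_space_def)
    show "\<alpha> = (\<Sum>a\<in>A. (\<lambda>y. \<alpha> a * \<phi> a y))"
    proof
      fix y
      show "\<alpha> y = (\<Sum>a\<in>A. (\<lambda>y. \<alpha> a * \<phi> a y)) y"
      proof (cases "y \<in> V")
        case True
        have "y = (\<Sum>a\<in>A. scale (representation A y a) a)"
          using sum_representation_eq[OF A(2) _ finA] True spanA by simp
        then have "\<alpha> y = \<alpha> (\<Sum>a\<in>A. scale (representation A y a) a)" by simp
        also have "\<dots> = (\<Sum>a\<in>A. \<alpha> (scale (representation A y a) a))"
          using A(1) by (intro linear_map_on_sum[OF lin]) auto
        also have "\<dots> = (\<Sum>a\<in>A. \<alpha> a * \<phi> a y)"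
          using A(1) True
          by (intro sum.cong) (auto simp: \<phi>_def dual_space_simps[OF \<alpha>] mult.commute)
        finally show ?thesis by (simp add: sum_fun_apply)
      qed (simp add: dual_space_outside[OF \<alpha>] sum_fun_apply \<phi>_def)
    qed
  qed
qed

text \<open>A finite spanning set is the union of a spanning set of \<open>V\<close> in the first
  component and the dual basis in the second.\<close>

lemma fin_dim_space_double: "fin_dim_space (double_scale scale) (double_space scale V)"
proof -
  interpret D: vector_space "double_scale scale"
    by (rule vector_space_double_scale) unfold_locales
  have sub: "D.subspace (double_space scale V)"
    by (rule D.subspaceI)
      (auto simp: double_space_def zero_prod_def double_scale_def dual_space_outside
        dual_space_simps algebra_simps intro!: dual_spaceI)
  obtain F where F: "finite F" "span F = V" using finitely_spanned by blast
  obtain A \<phi> where A: "finite A" "\<And>a. a \<in> A \<Longrightarrow> \<phi> a \<in> dual_space scale V"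
    "\<And>\<alpha>. \<alpha> \<in> dual_space scale V \<Longrightarrow> \<alpha> = (\<Sum>a\<in>A. (\<lambda>y. \<alpha> a * \<phi> a y))"
    using dual_space_finitely_spanned by blast
  define G where "G = (\<lambda>x. (x, 0)) ` F \<union> (\<lambda>a. (0, \<phi> a)) ` A"
  have "F \<subseteq> V" using F(2) span_superset by blast
  then have "G \<subseteq> double_space scale V"
    using A(2) by (auto simp: G_def double_space_def zero_in_dual)
  then have "D.span G \<subseteq> double_space scale V"
    using sub by (rule D.span_minimal)
  moreover have "double_space scale V \<subseteq> D.span G"
  proof
    fix p assume "p \<in> double_space scale V"
    then obtain x \<alpha> where p: "p = (x, \<alpha>)" "x \<in> V" "\<alpha> \<in> dual_space scale V"
      by (auto simp: double_space_def)
    \<comment> \<open>The preimage of the span of \<open>G\<close> under the embedding of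
      \<open>x\<close> as \<open>(x, 0)\<close> is a subspace. It contains \<open>F\<close>, hence
      all of \<open>V\<close>, which handles the first component without choosing
      coordinates.\<close>
    have subsp: "subspace {x. (x, 0) \<in> D.span G}"
    proof (rule subspaceI)
      fix x y assume "x \<in> {x. (x, 0) \<in> D.span G}" "y \<in> {x. (x, 0) \<in> D.span G}"
      then show "x + y \<in> {x. (x, 0) \<in> D.span G}"
        using D.span_add[of "(x, 0)" G "(y, 0)"] by simp
    next
      fix c x assume "x \<in> {x. (x, 0) \<in> D.span G}"
      then show "scale c x \<in> {x. (x, 0) \<in> D.span G}"
        using D.span_scale[of "(x, 0)" G c] by (simp add: double_scale_def zero_fun_def)
    qed (use D.span_zero[of G] in \<open>simp add: zero_prod_def\<close>)
    have "F \<subseteq> {x. (x, 0) \<in> D.span G}"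
      by (auto simp: G_def intro: D.span_base)
    then have 1: "(x, 0) \<in> D.span G"
      using span_minimal[OF _ subsp] p(2) F(2) by blast
    \<comment> \<open>The dual basis expansion of \<alpha>, embedded in the second
      component.\<close>
    have "(\<Sum>a\<in>A. double_scale scale (\<alpha> a) (0, \<phi> a)) \<in> D.span G"
      by (intro D.span_sum D.span_scale D.span_base) (auto simp: G_def)
    also have "(\<Sum>a\<in>A. double_scale scale (\<alpha> a) (0, \<phi> a)) = (0, \<alpha>)"
      using A(3)[OF p(3)] by (simp add: prod_eq_iff fst_sum snd_sum double_scale_def)
    finally show "p \<in> D.span G"
      using D.span_add[OF 1] p(1) by fastforce
  qed
  moreover have "finite G" using F(1) A(1) by (simp add: G_def)
  ultimately show ?thesis
    using sub by unfold_locales blast+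
qed

end

section \<open>Calculus of the bracket, the twist and their duals\<close>

context hom_lie_algebra
begin

lemma bracket_linear:
  assumes "x \<in> V"
  shows "linear_map_on scale V scale V (\<mu> x)" "linear_map_on scale V scale V (\<lambda>y. \<mu> y x)"
  using bilinear assms by (simp_all add: bilinear_map_on_def)

lemma bracket_simps:
  assumes "x \<in> V" "y \<in> V"
  shows "\<mu> x y \<in> V" "z \<in> V \<Longrightarrow> \<mu> (x + z) y = \<mu> x y + \<mu> z y"
    "z \<in> V \<Longrightarrow> \<mu> x (y + z) = \<mu> x y + \<mu> x z"
    "\<mu> (scale c x) y = scale c (\<mu> x y)" "\<mu> x (scale c y) = scale c (\<mu> x y)"
    "\<mu> x (- y) = - \<mu> x y" "\<mu> (- x) y = - \<mu> x y"
  using assms bracket_linear[OF assms(1)] bracket_linear[OF assms(2)]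
    linear_map_on_neg[OF bracket_linear(1)[OF assms(1)] assms(2)]
    linear_map_on_neg[OF bracket_linear(2)[OF assms(2)] assms(1)]
  by (simp_all add: linear_map_on_def)

lemma twist_simps:
  assumes "x \<in> V"
  shows "T x \<in> V" "y \<in> V \<Longrightarrow> T (x + y) = T x + T y" "T (scale c x) = scale c (T x)"
    "T (- x) = - T x"
  using assms linear_twist linear_map_on_neg[OF linear_twist] by (simp_all add: linear_map_on_def)

lemma coadjoint_in_dual:
  "x \<in> V \<Longrightarrow> \<alpha> \<in> dual_space scale V \<Longrightarrow> coadjoint V \<mu> x \<alpha> \<in> dual_space scale V"
  by (rule dual_spaceI) (simp_all add: coadjoint_def bracket_simps dual_space_simps)

lemma dual_map_in_dual:
  "\<alpha> \<in> dual_space scale V \<Longrightarrow> dual_map V T \<alpha> \<in> dual_space scale V"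
  by (rule dual_spaceI) (simp_all add: dual_map_def twist_simps dual_space_simps)

lemma dual_diff:
  "\<alpha> \<in> dual_space scale V \<Longrightarrow> \<beta> \<in> dual_space scale V \<Longrightarrow> \<alpha> - \<beta> \<in> dual_space scale V"
  by (rule dual_spaceI) (simp_all add: dual_space_simps dual_space_outside algebra_simps)

text \<open>The centroid condition moves \<open>T\<close> through the left argument only; applying
  skew-symmetry before and after carries it to the right one.\<close>

lemma centroid_right:
  assumes "in_centroid V \<mu> T" "x \<in> V" "y \<in> V"
  shows "\<mu> x (T y) = T (\<mu> x y)"
proof -
  have "\<mu> x (T y) = - \<mu> (T y) x" using assms by (simp add: skew_symmetric[of x] twist_simps)
  also have "\<dots> = - T (\<mu> y x)" using assms by (simp add: in_centroid_def)
  also have "\<dots> = T (\<mu> x y)" using assms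
    by (simp add: skew_symmetric[of x y] twist_simps bracket_simps)
  finally show ?thesis .
qed

text \<open>This is Hom-Jacobi for \<open>y\<close>, \<open>z\<close>, \<open>w\<close> with the
  twists moved to the places where the coadjoint action and the dual twist put them in the double.
  Oriented as a rewrite rule, it eliminates the terms with \<open>T\<close> outermost.\<close>

lemma centroid_jacobi:
  assumes c: "in_centroid V \<mu> T" and V: "y \<in> V" "z \<in> V" "w \<in> V"
  shows "T (\<mu> (\<mu> y z) w) = \<mu> y (\<mu> (T z) w) - \<mu> z (\<mu> (T y) w)"
proof -
  note left = c[unfolded in_centroid_def, rule_format]
  have "T (\<mu> (\<mu> y z) w) = - \<mu> (T w) (\<mu> y z)"
    using V by (simp add: skew_symmetric[of "T w"] bracket_simps twist_simps
        centroid_right[OF c, of "\<mu> y z" w])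
  also have "\<dots> = \<mu> (T y) (\<mu> z w) + \<mu> (T z) (\<mu> w y)"
    using hom_jacobi[of y z w] V by (intro minus_unique) (simp add: ac_simps)
  also have "\<mu> (T y) (\<mu> z w) = \<mu> y (\<mu> (T z) w)"
    using V by (simp add: left[symmetric] centroid_right[OF c] bracket_simps)
  also have "\<mu> (T z) (\<mu> w y) = - \<mu> z (\<mu> (T y) w)"
    using V by (simp add: left[symmetric] centroid_right[OF c] bracket_simps
        skew_symmetric[of w y] twist_simps)
  finally show ?thesis by simp
qed

section \<open>The Hom-Lie structure on the double\<close>

lemma hom_lie_algebra_double:
  assumes c: "in_centroid V \<mu> T"
  shows "hom_lie_algebra (double_scale scale) (double_space scale V)
    (double_bracket V \<mu>) (double_twist V T)"
proof -
  interpret D: fin_dim_space "double_scale scale" "double_space scale V"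
    by (rule fin_dim_space_double)
  have closed: "double_bracket V \<mu> p q \<in> double_space scale V"
    if "p \<in> double_space scale V" "q \<in> double_space scale V" for p q
    using that
    by (auto simp: double_space_def double_bracket_def bracket_simps coadjoint_in_dual dual_diff)
  show ?thesis
  proof
    show "bilinear_map_on (double_scale scale) (double_space scale V) (double_scale scale)
      (double_space scale V) (double_bracket V \<mu>)"
      unfolding bilinear_map_on_def linear_map_on_def
      by (intro conjI ballI allI closed)
        (auto simp: double_space_def double_bracket_def double_scale_def bracket_simps
          fun_eq_iff coadjoint_def dual_space_simps algebra_simps)
    show "linear_map_on (double_scale scale) (double_space scale V) (double_scale scale)
      (double_space scale V) (double_twist V T)"
      unfolding linear_map_on_def
      by (auto simp: double_space_def double_twist_def double_scale_def twist_simps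
          dual_map_in_dual[unfolded dual_map_def] fun_eq_iff dual_map_def)
    show "double_bracket V \<mu> p q = - double_bracket V \<mu> q p"
      if "p \<in> double_space scale V" "q \<in> double_space scale V" for p q
      using that
      by (auto simp: double_space_def double_bracket_def fun_eq_iff coadjoint_def
          intro: skew_symmetric)
  next
    fix p q r
    assume "p \<in> double_space scale V" "q \<in> double_space scale V" "r \<in> double_space scale V"
    then obtain x \<alpha> y \<beta> z \<gamma> where p: "p = (x, \<alpha>)" "q = (y, \<beta>)" "r = (z, \<gamma>)"
      and V: "x \<in> V" "y \<in> V" "z \<in> V"
      and d: "\<alpha> \<in> dual_space scale V" "\<beta> \<in> dual_space scale V" "\<gamma> \<in> dual_space scale V"
      by (auto simp: double_space_def)
    show "double_bracket V \<mu> (double_twist V T p) (double_bracket V \<mu> q r) +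
       double_bracket V \<mu> (double_twist V T q) (double_bracket V \<mu> r p) +
       double_bracket V \<mu> (double_twist V T r) (double_bracket V \<mu> p q) = 0"
      \<comment> \<open>At \<open>w\<close> in \<open>V\<close>, the terms with \<alpha> are
        \<alpha> applied to \<open>T (\<mu> (\<mu> y z) w)\<close>, minus \<alpha> of
        \<open>\<mu> y (\<mu> (T z) w)\<close>, plus \<alpha> of
        \<open>\<mu> z (\<mu> (T y) w)\<close>. They cancel by \<open>centroid_jacobi\<close>; the
        terms with \<beta> and \<gamma> are the cyclic analogues.\<close>
      unfolding p using V d hom_jacobi[OF V]
      by (simp add: double_bracket_def double_twist_def zero_prod_def fun_eq_iff coadjoint_def
          dual_map_def bracket_simps twist_simps centroid_jacobi[OF c] dual_space_simps)
  qed
qed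

section \<open>The invariant form and the centroid of the double\<close>

lemma quadratic_hom_lie_algebra_double:
  assumes c: "in_centroid V \<mu> T"
  shows "quadratic_hom_lie_algebra (double_scale scale) (double_space scale V)
    (double_bracket V \<mu>) (double_twist V T) double_form"
proof -
  interpret D: hom_lie_algebra "double_scale scale" "double_space scale V"
    "double_bracket V \<mu>" "double_twist V T"
    by (rule hom_lie_algebra_double[OF c])
  show ?thesis
  proof
    show "bilinear_map_on (double_scale scale) (double_space scale V) (*) UNIV double_form"
      unfolding bilinear_map_on_def linear_map_on_def
      by (auto simp: double_space_def double_form_def double_scale_def dual_space_simps
          algebra_simps)
    show "double_form p q = double_form q p" for p q :: "'v \<times> ('v \<Rightarrow> 'f)"
      by (simp add: double_form_def split_beta add.commute)
  next
    fix p assume "p \<in> double_space scale V"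
      and orth: "\<And>q. q \<in> double_space scale V \<Longrightarrow> double_form p q = 0"
    then obtain x \<alpha> where p: "p = (x, \<alpha>)" "x \<in> V" "\<alpha> \<in> dual_space scale V"
      by (auto simp: double_space_def)
    \<comment> \<open>Pairing with \<open>(y, 0)\<close> kills \<alpha> on \<open>V\<close>, and
      outside \<open>V\<close> it is 0 by convention. Pairing with \<open>(0, \<beta>)\<close> then
      shows that every form vanishes at \<open>x\<close>.\<close>
    have "\<alpha> y = 0" for y
      using orth[of "(y, 0)"] p zero_in_dual dual_space_outside
      by (cases "y \<in> V") (auto simp: double_space_def double_form_def)
    moreover have forms: "\<beta> x = 0" if "\<beta> \<in> dual_space scale V" for \<beta>
      using orth[of "(0, \<beta>)"] p that calculation by (simp add: double_space_def double_form_def)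
    have "x = 0"
    proof (rule ccontr)
      assume "x \<noteq> 0"
      then have ind: "independent {x}" by simp
      \<comment> \<open>A form with value 1 at \<open>x\<close>: the coordinate along
        \<open>x\<close> in a basis of the whole ambient space that contains \<open>x\<close>, cut
        off outside \<open>V\<close>.\<close>
      define \<beta> where "\<beta> y = (if y \<in> V then representation (extend_basis {x}) y x else 0)" for y
      have I: "independent (extend_basis {x})" "span (extend_basis {x}) = UNIV"
        using ind by (simp_all add: independent_extend_basis)
      have "\<beta> \<in> dual_space scale V"
        by (rule dual_spaceI)
          (simp_all add: \<beta>_def representation_add[OF I(1)] representation_scale[OF I(1)] I(2))
      moreover have "\<beta> x = 1"
        using representation_basis[OF I(1), of x] extend_basis_superset[OF ind] p(2)
        by (simp add: \<beta>_def)
      ultimately show False using forms by force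
    qed
    ultimately show "p = 0" using p(1) by (simp add: zero_prod_def fun_eq_iff)
  next
    fix p q r
    assume "p \<in> double_space scale V" "q \<in> double_space scale V" "r \<in> double_space scale V"
    then obtain x \<alpha> y \<beta> z \<gamma> where p: "p = (x, \<alpha>)" "q = (y, \<beta>)" "r = (z, \<gamma>)"
      and V: "x \<in> V" "y \<in> V" "z \<in> V"
      and d: "\<alpha> \<in> dual_space scale V" "\<beta> \<in> dual_space scale V" "\<gamma> \<in> dual_space scale V"
      by (auto simp: double_space_def)
    \<comment> \<open>By skew-symmetry both sides equal the cyclic sum of
      \<open>\<alpha> (\<mu> y z)\<close>, \<open>\<beta> (\<mu> z x)\<close> and
      \<open>\<gamma> (\<mu> x y)\<close>.\<close>
    show "double_form (double_bracket V \<mu> p q) r = double_form p (double_bracket V \<mu> q r)"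
      unfolding p using V d
      by (simp add: double_bracket_def double_form_def coadjoint_def skew_symmetric[of y x]
          skew_symmetric[of z x] bracket_simps dual_space_simps)
  next
    fix p q
    assume "p \<in> double_space scale V" "q \<in> double_space scale V"
    then show "double_form (double_twist V T p) q = double_form p (double_twist V T q)"
      by (auto simp: double_space_def double_form_def double_twist_def dual_map_def)
  qed
qed

text \<open>In the dual component at \<open>w\<close>, the \<beta> terms agree because
  \<open>\<mu> x (T w)\<close> and \<open>\<mu> (T x) w\<close> both equal
  \<open>T (\<mu> x w)\<close>, and the \<alpha> terms because \<open>\<mu> y (T w)\<close> is
  \<open>T (\<mu> y w)\<close>. This is where the centroid condition is used on both
  arguments.\<close>

lemma in_centroid_double:
  assumes c: "in_centroid V \<mu> T"
  shows "in_centroid (double_space scale V) (double_bracket V \<mu>) (double_twist V T)"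
  using c centroid_right[OF c]
  by (auto simp: in_centroid_def double_space_def double_bracket_def double_twist_def
      coadjoint_def dual_map_def fun_eq_iff bracket_simps twist_simps)

end

theorem proposition1p7:
  fixes scale :: "'f::{alg_closed_field, field_char_0} \<Rightarrow> 'v::ab_group_add \<Rightarrow> 'v"
    and H :: "'v set" and \<nu> :: "'v \<Rightarrow> 'v \<Rightarrow> 'v" and S :: "'v \<Rightarrow> 'v"
  assumes "hom_lie_algebra scale H \<nu> S"
    and "in_centroid H \<nu> S"
  shows "quadratic_hom_lie_algebra (double_scale scale) (double_space scale H)
           (double_bracket H \<nu>) (double_twist H S) double_form
         \<and> in_centroid (double_space scale H) (double_bracket H \<nu>) (double_twist H S)"
  using hom_lie_algebra.quadratic_hom_lie_algebra_double[OF assms]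
    hom_lie_algebra.in_centroid_double[OF assms] by blast

end
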